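(* Let $k\ge 2$ and let $S$ be a bilateral operator valued weighted shift on $\mathbb{C}^k$ (acting in $\ell_2(\mathbb{Z},\mathbb{C}^k)$) whose weights $\{S_n\}_{n\in\mathbb{Z}}$ are normal and commute with each other. Then there is a bilateral operator valued weighted shift $D$ on $\mathbb{C}^k$ with weights $\{D_n\}_{n\in\mathbb{Z}}$ such that $S$ is unitarily equivalent to $D$ and $D_n$ is a diagonal operator on $\mathbb{C}^k$ (i.e. given by a diagonal $k\times k$ matrix) for each $n\in\mathbb{Z}$.
   Context: $\boldsymbol{B}(\mathcal{K})$ is the algebra of bounded linear operators on a Hilbert space $\mathcal{K}$. For a Hilbert space $\mathcal{H}$, $\ell_2(\mathbb{Z},\mathcal{H})=\bigoplus_{n\in\mathbb{Z}}\mathcal{H}$ is the Hilbert space of two-sided sequences $x=(x_n)_{n\in\mathbb{Z}}$ in $\mathcal{H}$ with $\sum_{n}\|x_n\|^2<\infty$. Bilateral operator valued weighted shift: given a two-sided sequence $\{S_n\}_{n\in\mathbb{Z}}\subseteq\boldsymbol{B}(\mathcal{H})$ of nonzero operators with $\{\|S_n\|\}_{n\in\mathbb{Z}}$ bounded, it is the operator $S\in\boldsymbol{B}(\ell_2(\mathbb{Z},\mathcal{H}))$ defined by $(Sx)_n=S_n x_{n-1}$, $n\in\mathbb{Z}$; the $S_n$ are its weights. Operators $S,T\in \boldsymbol{B}(\ell_2(\mathbb{Z},\mathcal{H}))$ are unitarily equivalent if $US=TU$ for some unitary $U\in \boldsymbol{B}(\ell_2(\mathbb{Z},\mathcal{H}))$.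 *)

theory Defs
  imports "HOL-Analysis.Analysis"
begin

section \<open>Operators on the Hilbert space of complex k-tuples\<close>

text \<open>The space is \<^typ>\<open>complex^'n\<close> with k the cardinality of the index type. Its library
  norm is the Euclidean one, but the library inner product on it is only real-valued.\<close>

definition cinner_vec :: "complex^'n \<Rightarrow> complex^'n \<Rightarrow> complex" where
  "cinner_vec x y = (\<Sum>i\<in>UNIV. x $ i * cnj (y $ i))"

lemma cinner_vec_self: "cinner_vec x x = of_real ((norm x)\<^sup>2)"
  by (simp add: cinner_vec_def norm_vec_def L2_set_def sum_nonneg complex_norm_square del: of_real_power)

text \<open>Complex linearity; boundedness is automatic in finite dimension, see
  \<open>vec_op_bounded_linear\<close> below.\<close>

definition vec_op :: "(complex^'n \<Rightarrow> complex^'n) \<Rightarrow> bool" where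
  "vec_op A \<longleftrightarrow> Vector_Spaces.linear (*s) (*s) A"

definition vec_adjoint_pair ::
    "(complex^'n \<Rightarrow> complex^'n) \<Rightarrow> (complex^'n \<Rightarrow> complex^'n) \<Rightarrow> bool" where
  "vec_adjoint_pair A B \<longleftrightarrow> (\<forall>x y. cinner_vec (A x) y = cinner_vec x (B y))"

definition normal_vec_op :: "(complex^'n \<Rightarrow> complex^'n) \<Rightarrow> bool" where
  "normal_vec_op A \<longleftrightarrow>
     vec_op A \<and> (\<exists>B. vec_op B \<and> vec_adjoint_pair A B \<and> A \<circ> B = B \<circ> A)"

definition diagonal_vec_op :: "(complex^'n \<Rightarrow> complex^'n) \<Rightarrow> bool" where
  "diagonal_vec_op A \<longleftrightarrow>
     (\<exists>M :: complex^'n^'n. (\<forall>i j. i \<noteq> j \<longrightarrow> M $ i $ j = 0) \<and> A = (\<lambda>x. M *v x))"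

lemma vec_op_bounded_linear:
  assumes "vec_op A"
  shows "bounded_linear A"
proof -
  interpret A: Vector_Spaces.linear "(*s)" "(*s)" A
    using assms by (simp add: vec_op_def)
  have sc: "r *\<^sub>R x = complex_of_real r *s x" for r and x :: "complex^'n"
    by (simp add: vec_eq_iff scaleR_conv_of_real[where 'a = complex])
  have "linear A"
    by (rule linearI) (simp_all add: A.add A.scale sc)
  then show ?thesis
    by (simp add: linear_conv_bounded_linear)
qed


section \<open>Square-summable two-sided sequences\<close>

text \<open>Operators are functions on all two-sided sequences, considered only on the carrier
  \<open>ell2\<close>; their values outside of it are irrelevant.\<close>

definition ell2 :: "(int \<Rightarrow> complex^'n) set" where
  "ell2 = {x. (\<lambda>n. (norm (x n))\<^sup>2) summable_on UNIV}"

definition ell2_inner :: "(int \<Rightarrow> complex^'n) \<Rightarrow> (int \<Rightarrow> complex^'n) \<Rightarrow> complex" where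
  "ell2_inner x y = (\<Sum>\<^sub>\<infinity>n. cinner_vec (x n) (y n))"

definition ell2_norm :: "(int \<Rightarrow> complex^'n) \<Rightarrow> real" where
  "ell2_norm x = sqrt (\<Sum>\<^sub>\<infinity>n. (norm (x n))\<^sup>2)"

definition ell2_op :: "((int \<Rightarrow> complex^'n) \<Rightarrow> (int \<Rightarrow> complex^'n)) \<Rightarrow> bool" where
  "ell2_op T \<longleftrightarrow>
     (\<forall>x\<in>ell2. T x \<in> ell2) \<and>
     (\<forall>x\<in>ell2. \<forall>y\<in>ell2. T (\<lambda>n. x n + y n) = (\<lambda>n. T x n + T y n)) \<and>
     (\<forall>c. \<forall>x\<in>ell2. T (\<lambda>n. c *s x n) = (\<lambda>n. c *s T x n)) \<and>
     (\<exists>C. \<forall>x\<in>ell2. ell2_norm (T x) \<le> C * ell2_norm x)"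

text \<open>The operator \<open>V\<close> is the Hilbert space adjoint of \<open>U\<close>, and both products are the identity.\<close>

definition ell2_unitary :: "((int \<Rightarrow> complex^'n) \<Rightarrow> (int \<Rightarrow> complex^'n)) \<Rightarrow> bool" where
  "ell2_unitary U \<longleftrightarrow>
     ell2_op U \<and>
     (\<exists>V. ell2_op V \<and>
          (\<forall>x\<in>ell2. \<forall>y\<in>ell2. ell2_inner (U x) y = ell2_inner x (V y)) \<and>
          (\<forall>x\<in>ell2. V (U x) = x \<and> U (V x) = x))"

definition unitarily_equivalent ::
    "((int \<Rightarrow> complex^'n) \<Rightarrow> (int \<Rightarrow> complex^'n)) \<Rightarrow>
     ((int \<Rightarrow> complex^'n) \<Rightarrow> (int \<Rightarrow> complex^'n)) \<Rightarrow> bool" where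
  "unitarily_equivalent S T \<longleftrightarrow>
     ell2_op S \<and> ell2_op T \<and> (\<exists>U. ell2_unitary U \<and> (\<forall>x\<in>ell2. U (S x) = T (U x)))"


section \<open>Bilateral operator valued weighted shifts\<close>

definition shift_weights :: "(int \<Rightarrow> complex^'n \<Rightarrow> complex^'n) \<Rightarrow> bool" where
  "shift_weights S \<longleftrightarrow>
     (\<forall>n. vec_op (S n) \<and> S n \<noteq> (\<lambda>x. 0)) \<and> bdd_above (range (\<lambda>n. onorm (S n)))"

definition bilateral_shift ::
    "(int \<Rightarrow> complex^'n \<Rightarrow> complex^'n) \<Rightarrow> (int \<Rightarrow> complex^'n) \<Rightarrow> (int \<Rightarrow> complex^'n)" where
  "bilateral_shift S x = (\<lambda>n. S n (x (n - 1)))"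

lemma bilateral_shift_ell2_op:
  assumes "shift_weights S"
  shows "ell2_op (bilateral_shift S)"
proof -
  obtain M where M: "onorm (S n) \<le> M" for n
    using assms by (auto simp: shift_weights_def bdd_above_def)
  have op: "vec_op (S n)" for n
    using assms by (simp add: shift_weights_def)
  have nb: "norm (S n v) \<le> M * norm v" for n v
    using onorm[OF vec_op_bounded_linear[OF op], of n v] M[of n]
    by (meson mult_right_mono norm_ge_zero order_trans)
  have M0: "M \<ge> 0"
    using onorm_pos_le[OF vec_op_bounded_linear[OF op]] M order_trans by blast
  have sq: "(norm (S n v))\<^sup>2 \<le> M\<^sup>2 * (norm v)\<^sup>2" for n v
    using power_mono[OF nb, of n v 2] by (simp add: power_mult_distrib)
  have bij: "bij (\<lambda>n::int. n - 1)"
    by (rule bijI') (auto intro: exI[of _ "_ + 1"])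
  have shs: "(\<lambda>n. M\<^sup>2 * (norm (x (n - 1)))\<^sup>2) summable_on UNIV" if "x \<in> ell2" for x :: "int \<Rightarrow> complex^'a"
    using that summable_on_reindex_bij_betw[OF bij, of "\<lambda>n. (norm (x n))\<^sup>2"]
    by (auto simp: ell2_def intro!: summable_on_cmult_right)
  have shi: "(\<Sum>\<^sub>\<infinity>n. M\<^sup>2 * (norm (x (n - 1)))\<^sup>2) = M\<^sup>2 * (\<Sum>\<^sub>\<infinity>n. (norm (x n))\<^sup>2)"
    for x :: "int \<Rightarrow> complex^'a"
    using infsum_reindex_bij_betw[OF bij, of "\<lambda>n. (norm (x n))\<^sup>2"]
    by (simp add: infsum_cmult_right')
  have mem: "bilateral_shift S x \<in> ell2" if "x \<in> ell2" for x
    unfolding ell2_def bilateral_shift_def mem_Collect_eq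
    by (rule summable_on_comparison_test[OF shs[OF that]]) (auto intro: sq)
  have "ell2_norm (bilateral_shift S x) \<le> M * ell2_norm x" if "x \<in> ell2" for x
  proof -
    have "(\<Sum>\<^sub>\<infinity>n. (norm (bilateral_shift S x n))\<^sup>2) \<le> (\<Sum>\<^sub>\<infinity>n. M\<^sup>2 * (norm (x (n - 1)))\<^sup>2)"
      using mem[OF that] shs[OF that]
      by (intro infsum_mono) (auto simp: ell2_def bilateral_shift_def sq)
    then have "ell2_norm (bilateral_shift S x) \<le> sqrt (M\<^sup>2 * (\<Sum>\<^sub>\<infinity>n. (norm (x n))\<^sup>2))"
      unfolding ell2_norm_def shi by (rule real_sqrt_le_mono)
    then show ?thesis
      using M0 by (simp add: ell2_norm_def real_sqrt_mult)
  qed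
  moreover have "S n (v + w) = S n v + S n w" and "S n (c *s v) = c *s S n v" for n v w c
    using op[of n] by (simp_all add: vec_op_def Vector_Spaces.linear_iff)
  ultimately show ?thesis
    using mem unfolding ell2_op_def by (auto simp: bilateral_shift_def)
qed

end

(* Commuting operators on a complex space leave each other's eigenspaces invariant, so a nonzero
   jointly invariant subspace of minimal dimension lies in a single eigenspace of each of them:
   common eigenvectors exist. For normal operators the orthogonal complement of common
   eigenvectors is again jointly invariant, which yields an orthonormal basis of common
   eigenvectors. The unitary W of this basis diagonalizes all weights at once, and applying its
   adjoint in each coordinate intertwines the two shifts. *)

theory Submission
  imports Defs "HOL-Computational_Algebra.Fundamental_Theorem_Algebra"
begin

section \<open>Eigenvectors in invariant subspaces\<close>

lemma vec_op_add: "vec_op A \<Longrightarrow> A (x + y) = A x + A y"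
  and vec_op_scale: "vec_op A \<Longrightarrow> A (c *s x) = c *s A x"
  by (simp_all add: vec_op_def Vector_Spaces.linear_iff)

lemma vec_op_0: "vec_op A \<Longrightarrow> A 0 = 0"
  using vec_op_scale[of A 0 0] by simp

lemma vec_op_diff: "vec_op A \<Longrightarrow> A (x - y) = A x - A y"
  using vec_op_add[of A "x - y" y] by (simp add: algebra_simps)

lemma vec_op_sum: "vec_op A \<Longrightarrow> A (\<Sum>i\<in>I. f i) = (\<Sum>i\<in>I. A (f i))"
  by (induction I rule: infinite_finite_induct) (simp_all add: vec_op_0 vec_op_add)

text \<open>This is the vector p(A) w. With \<open>A\<close> and \<open>w\<close> fixed it depends
  linearly on p, so dependences among the iterates of w become polynomials.\<close>

definition poly_op ::
    "(complex^'n \<Rightarrow> complex^'n) \<Rightarrow> complex^'n \<Rightarrow> complex poly \<Rightarrow> complex^'n" where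
  "poly_op A w p = (\<Sum>i\<le>degree p. coeff p i *s (A ^^ i) w)"

text \<open>Coefficients above the degree vanish, so polynomials of different degrees can be
  evaluated over one common range of summation.\<close>

lemma poly_op_eq_sum:
  assumes "degree p \<le> N"
  shows "poly_op A w p = (\<Sum>i\<le>N. coeff p i *s (A ^^ i) w)"
  unfolding poly_op_def using assms
  by (intro sum.mono_neutral_left) (auto simp: coeff_eq_0)

lemma poly_op_add: "poly_op A w (p + q) = poly_op A w p + poly_op A w q"
proof -
  define N where "N = max (degree p) (degree q)"
  have "degree p \<le> N" "degree q \<le> N" "degree (p + q) \<le> N"
    by (auto simp: N_def degree_add_le)
  then show ?thesis
    by (simp add: poly_op_eq_sum vec.scale_left_distrib sum.distrib)
qed

lemma poly_op_smult: "poly_op A w (smult c p) = c *s poly_op A w p"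
  by (simp add: poly_op_eq_sum[of "smult c p" "degree p"] poly_op_eq_sum[of p "degree p"]
      degree_smult_le vec.scale_sum_right)

lemma poly_op_monom: "poly_op A w (monom 1 m) = (A ^^ m) w"
proof -
  have "poly_op A w (monom 1 m) = (\<Sum>i\<le>m. if i = m then (A ^^ m) w else 0)"
    unfolding poly_op_eq_sum[OF degree_monom_le]
    by (intro sum.cong) auto
  then show ?thesis by simp
qed

text \<open>\<open>pCons a p\<close> is a + X p, and linearity pulls one factor A out of the sum;
  this is how a linear factor X - z will be evaluated.\<close>

lemma poly_op_pCons:
  assumes "vec_op A"
  shows "poly_op A w (pCons a p) = a *s w + A (poly_op A w p)"
proof -
  have "poly_op A w (pCons a p) = (\<Sum>i\<le>Suc (degree p). coeff (pCons a p) i *s (A ^^ i) w)"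
    by (rule poly_op_eq_sum) (rule degree_pCons_le)
  also have "\<dots> = a *s w + (\<Sum>i\<le>degree p. coeff p i *s A ((A ^^ i) w))"
    by (subst sum.atMost_Suc_shift) simp
  finally show ?thesis
    by (simp add: poly_op_def vec_op_sum[OF assms] vec_op_scale[OF assms])
qed

lemma poly_op_mem:
  assumes "vec.subspace W" "\<And>x. x \<in> W \<Longrightarrow> A x \<in> W" "w \<in> W"
  shows "poly_op A w p \<in> W"
proof -
  have "(A ^^ i) w \<in> W" for i
    by (induction i) (use assms in auto)
  then show ?thesis
    unfolding poly_op_def
    by (intro vec.subspace_sum vec.subspace_scale assms(1))
qed

text \<open>In finite dimension some iterate of w lies in the span of the earlier ones; such a
  dependence is a monic polynomial that kills w.\<close>

lemma exists_annihilating_poly: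
  fixes w :: "complex^'n"
  shows "\<exists>p. p \<noteq> 0 \<and> poly_op A w p = 0"
proof -
  define K where "K m = (\<lambda>i. (A ^^ i) w) ` {..<m}" for m
  have K_Suc: "K (Suc m) = insert ((A ^^ m) w) (K m)" for m
    by (auto simp: K_def lessThan_Suc)
  have "\<exists>m. (A ^^ m) w \<in> vec.span (K m)"
  proof (rule ccontr)
    assume none: "\<nexists>m. (A ^^ m) w \<in> vec.span (K m)"
    have "vec.dim (K m) = m" for m
    proof (induction m)
      case 0
      then show ?case by (simp add: K_def)
    next
      case (Suc m)
      then show ?case using none by (simp add: K_Suc vec.dim_insert)
    qed
    then show False
      \<comment> \<open>If every iterate enlarged the span, the first k + 1 of them would have
        dimension k + 1 inside a space of dimension k.\<close>
      using vec.dim_subset_UNIV[of "K (Suc CARD('n))"] by (simp add: vec.dimension_def card_cart_basis)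
  qed
  then obtain m where m: "(A ^^ m) w \<in> vec.span (K m)" by blast
  \<comment> \<open>The vectors q(A) w with q of degree below m. The condition on coefficients also
    covers m = 0, where only q = 0 remains. \<open>V\<close> is a subspace containing the first m
    iterates, hence their span.\<close>
  define V where "V = poly_op A w ` {p. \<forall>i\<ge>m. coeff p i = 0}"
  have "vec.subspace V"
    unfolding vec.subspace_def
  proof (intro conjI ballI allI)
    show "0 \<in> V"
      unfolding V_def by (rule image_eqI[of _ _ 0]) (auto simp: poly_op_def)
    fix x y c assume "x \<in> V" "y \<in> V"
    then obtain p q where pq: "x = poly_op A w p" "y = poly_op A w q"
      "\<forall>i\<ge>m. coeff p i = 0" "\<forall>i\<ge>m. coeff q i = 0"
      unfolding V_def by blast
    show "x + y \<in> V"
      unfolding V_def by (rule image_eqI[of _ _ "p + q"]) (auto simp: pq poly_op_add)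
    show "c *s x \<in> V"
      unfolding V_def by (rule image_eqI[of _ _ "smult c p"]) (auto simp: pq poly_op_smult)
  qed
  moreover have "K m \<subseteq> V"
    unfolding K_def V_def by (auto simp flip: poly_op_monom)
  ultimately have "vec.span (K m) \<subseteq> V"
    by (intro vec.span_minimal)
  with m obtain q where q: "(A ^^ m) w = poly_op A w q" "coeff q m = 0"
    unfolding V_def by blast
  show ?thesis
  proof (intro exI conjI)
    \<comment> \<open>This coefficient is 1, since q has no term of degree m.\<close>
    have "coeff (monom 1 m + smult (- 1) q) m \<noteq> 0"
      using q by simp
    then show "monom 1 m + smult (- 1) q \<noteq> 0"
      by (metis coeff_0)
    show "poly_op A w (monom 1 m + smult (- 1) q) = 0"
      unfolding poly_op_add poly_op_smult poly_op_monom q(1) by simp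
  qed
qed

text \<open>Take p of least degree with p(A) w = 0 for a nonzero w in \<open>W\<close>. A root z
  gives p = (X - z) q; by minimality q(A) w is nonzero, and A - z kills it.\<close>

lemma exists_eigenvector:
  fixes A :: "complex^'n \<Rightarrow> complex^'n"
  assumes A: "vec_op A" and W: "vec.subspace W" "\<And>x. x \<in> W \<Longrightarrow> A x \<in> W"
    and "W \<noteq> {0}"
  shows "\<exists>c. \<exists>v\<in>W. v \<noteq> 0 \<and> A v = c *s v"
proof -
  obtain w where w: "w \<in> W" "w \<noteq> 0"
    using \<open>W \<noteq> {0}\<close> vec.subspace_0[OF W(1)] by blast
  obtain p where p: "p \<noteq> 0 \<and> poly_op A w p = 0"
    and min: "\<And>q. q \<noteq> 0 \<and> poly_op A w q = 0 \<Longrightarrow> degree p \<le> degree q"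
    using exists_annihilating_poly[of A w] ex_has_least_nat[of "\<lambda>p. p \<noteq> 0 \<and> poly_op A w p = 0" _ degree]
    by blast
  \<comment> \<open>A nonzero constant cannot annihilate the nonzero vector w, so p has a
    root.\<close>
  have "degree p \<noteq> 0"
  proof
    assume "degree p = 0"
    then obtain a where "p = [:a:]" by (rule degree_eq_zeroE)
    with p w show False by (simp add: poly_op_def)
  qed
  then have "\<not> constant (poly p)"
    by (simp add: constant_degree)
  then obtain z where "poly p z = 0"
    by (rule fundamental_theorem_of_algebra[THEN exE])
  then obtain q where q: "p = [:- z, 1:] * q"
    by (auto simp: poly_eq_0_iff_dvd)
  with p have "q \<noteq> 0" by auto
  then have "degree p = Suc (degree q)"
    unfolding q by (subst degree_mult_eq) auto
  with min[of q] \<open>q \<noteq> 0\<close> have ne: "poly_op A w q \<noteq> 0" by auto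
  have "p = smult (- z) q + pCons 0 q"
    using q by simp
  with p have "(- z) *s poly_op A w q + A (poly_op A w q) = 0"
    by (simp only: poly_op_add poly_op_smult poly_op_pCons[OF A]) simp
  then have "A (poly_op A w q) = z *s poly_op A w q"
    by simp
  moreover have "poly_op A w q \<in> W"
    by (rule poly_op_mem[OF W w(1)])
  ultimately show ?thesis using ne by blast
qed

text \<open>Minimizing the dimension replaces an induction over the operators, so the family may be
  infinite: on a minimal subspace each operator is a scalar, and any nonzero vector there will
  do.\<close>

lemma exists_common_eigenvector:
  fixes S :: "'i \<Rightarrow> complex^'n \<Rightarrow> complex^'n"
  assumes op: "\<And>i. vec_op (S i)" and comm: "\<And>i j x. S i (S j x) = S j (S i x)"
    and "vec.subspace V" "\<And>i x. x \<in> V \<Longrightarrow> S i x \<in> V" "V \<noteq> {0}"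
  shows "\<exists>v\<in>V. v \<noteq> 0 \<and> (\<forall>i. \<exists>c. S i v = c *s v)"
proof -
  define P where "P W \<longleftrightarrow> vec.subspace W \<and> W \<subseteq> V \<and> W \<noteq> {0} \<and> (\<forall>i. \<forall>x\<in>W. S i x \<in> W)" for W
  have "P V" using assms by (auto simp: P_def)
  then obtain W where W: "P W" and min: "\<And>X. P X \<Longrightarrow> vec.dim W \<le> vec.dim X"
    using ex_has_least_nat[of P V vec.dim] by blast
  have "\<exists>c. \<forall>x\<in>W. S i x = c *s x" for i
  proof -
    obtain c v where v: "v \<in> W" "v \<noteq> 0" "S i v = c *s v"
      using exists_eigenvector[OF op, of W i] W unfolding P_def by blast
    \<comment> \<open>The eigenspace of \<open>S i\<close> inside \<open>W\<close>. Commutativity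
      makes it invariant under every \<open>S j\<close>, and v keeps it nonzero, so minimality
      forces it to be all of \<open>W\<close>.\<close>
    define X where "X = {x \<in> W. S i x = c *s x}"
    have sub: "vec.subspace X"
      using W unfolding P_def vec.subspace_def X_def
      by (auto simp: vec_op_0 vec_op_add vec_op_scale op vector_add_ldistrib mult.commute)
    moreover have "S j x \<in> X" if "x \<in> X" for j x
      using that W unfolding X_def P_def by (simp add: comm[of i j] vec_op_scale[OF op])
    ultimately have "P X"
      using W v unfolding P_def by (auto simp: X_def)
    then have "X = W"
      using min[of X] W sub unfolding P_def
      by (intro vec.subspace_dim_equal) (auto simp: X_def)
    then show ?thesis unfolding X_def by blast
  qed
  moreover obtain v where "v \<in> W" "v \<noteq> 0"
    using W vec.subspace_0[of W] unfolding P_def by blast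
  ultimately show ?thesis
    using W unfolding P_def by blast
qed


section \<open>Simultaneous unitary diagonalization\<close>

lemma cinner_vec_add_left: "cinner_vec (x + y) z = cinner_vec x z + cinner_vec y z"
  by (simp add: cinner_vec_def distrib_right sum.distrib)

lemma cinner_vec_diff_left: "cinner_vec (x - y) z = cinner_vec x z - cinner_vec y z"
  by (simp add: cinner_vec_def left_diff_distrib sum_subtractf)

lemma cinner_vec_scale_left: "cinner_vec (c *s x) y = c * cinner_vec x y"
  by (simp add: cinner_vec_def sum_distrib_left mult.assoc)

lemma cinner_vec_scale_right: "cinner_vec x (c *s y) = cnj c * cinner_vec x y"
  by (simp add: cinner_vec_def sum_distrib_left algebra_simps)

lemma cinner_vec_cnj: "cnj (cinner_vec x y) = cinner_vec y x"
  by (simp add: cinner_vec_def mult.commute)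

lemma cinner_vec_sum_left: "cinner_vec (\<Sum>i\<in>I. f i) y = (\<Sum>i\<in>I. cinner_vec (f i) y)"
  by (induction I rule: infinite_finite_induct)
    (simp_all add: cinner_vec_add_left, simp_all add: cinner_vec_def)

lemma cinner_vec_self_eq_0: "cinner_vec x x = 0 \<longleftrightarrow> x = 0"
  by (simp add: cinner_vec_self)

text \<open>An eigenvector v of a normal operator is also an eigenvector of its adjoint B, with the
  conjugate eigenvalue. Moving A across the inner product then leaves a multiple of the inner
  product of x and v.\<close>

lemma normal_eigenvector_complement:
  assumes "normal_vec_op A" and v: "A v = c *s v" and x: "cinner_vec x v = 0"
  shows "cinner_vec (A x) v = 0"
proof -
  obtain B where A: "vec_op A" and adj: "\<And>x y. cinner_vec (A x) y = cinner_vec x (B y)"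
    and comm: "\<And>x. A (B x) = B (A x)" and B: "vec_op B"
    using assms(1) unfolding normal_vec_op_def vec_adjoint_pair_def by (metis comp_apply)
  have adj': "cinner_vec (B x) y = cinner_vec x (A y)" for x y
    by (metis adj cinner_vec_cnj)
  \<comment> \<open>The defect in B v = \<open>cnj c *s v\<close>. As A commutes with B, u satisfies
    A u = c u; expanding the first argument of \<open>cinner_vec u u\<close> and moving B across
    makes the two terms cancel.\<close>
  define u where "u = B v - cnj c *s v"
  have "A u = c *s u"
    by (simp add: u_def vec_op_diff A vec_op_scale comm v B vec.scale_right_diff_distrib mult.commute)
  then have "cinner_vec (B v) u = cnj c * cinner_vec v u"
    by (simp add: adj' cinner_vec_scale_right)
  then have "cinner_vec u u = 0"
    by (subst (1) u_def) (simp add: cinner_vec_diff_left cinner_vec_scale_left)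
  then have "B v = cnj c *s v"
    by (simp add: cinner_vec_self_eq_0 u_def)
  then show ?thesis
    by (simp add: adj cinner_vec_scale_right x)
qed

definition corthonormal :: "(complex^'n) set \<Rightarrow> bool" where
  "corthonormal E \<longleftrightarrow> (\<forall>u\<in>E. \<forall>v\<in>E. cinner_vec u v = (if u = v then 1 else 0))"

text \<open>With a trivial complement every x would equal its orthogonal projection y onto the span
  of \<open>E\<close>, so fewer than k vectors would span the space.\<close>

lemma corthonormal_complement_nonzero:
  fixes E :: "(complex^'n) set"
  assumes E: "corthonormal E" "finite E" "card E < CARD('n)"
  shows "{x. \<forall>v\<in>E. cinner_vec x v = 0} \<noteq> {0}"
proof
  assume triv: "{x. \<forall>v\<in>E. cinner_vec x v = 0} = {0}"
  have "x \<in> vec.span E" for x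
  proof -
    define y where "y = (\<Sum>u\<in>E. cinner_vec x u *s u)"
    have "cinner_vec y v = cinner_vec x v" if "v \<in> E" for v
    proof -
      have "cinner_vec y v = (\<Sum>u\<in>E. if u = v then cinner_vec x v else 0)"
        unfolding y_def cinner_vec_sum_left cinner_vec_scale_left
        using E(1) that by (intro sum.cong) (auto simp: corthonormal_def)
      with that E(2) show ?thesis by simp
    qed
    then have "x - y \<in> {x. \<forall>v\<in>E. cinner_vec x v = 0}"
      by (simp add: cinner_vec_diff_left)
    then have "x = y" using triv by simp
    also have "y \<in> vec.span E"
      unfolding y_def by (intro vec.span_sum vec.span_scale vec.span_base)
    finally show ?thesis .
  qed
  then have "vec.dim (UNIV :: (complex^'n) set) \<le> card E"
    by (intro vec.dim_le_card) (use E in auto)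
  with E(3) show False by (simp add: card_cart_basis)
qed

text \<open>Induction on m: the orthogonal complement of \<open>E\<close> is nonzero while m < k and
  jointly invariant by normality, so it supplies one more common eigenvector, which is then
  normalized.\<close>

lemma exists_orthonormal_common_eigenvectors:
  fixes S :: "'i \<Rightarrow> complex^'n \<Rightarrow> complex^'n"
  assumes normal: "\<And>i. normal_vec_op (S i)" and comm: "\<And>i j x. S i (S j x) = S j (S i x)"
    and "m \<le> CARD('n)"
  shows "\<exists>E. finite E \<and> card E = m \<and> corthonormal E \<and> (\<forall>v\<in>E. \<forall>i. \<exists>c. S i v = c *s v)"
  using \<open>m \<le> CARD('n)\<close>
proof (induction m)
  case 0
  show ?case by (intro exI[of _ "{}"]) (simp add: corthonormal_def)
next
  case (Suc m)
  then obtain E where E: "finite E" "card E = m" "corthonormal E"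
    "\<And>v i. v \<in> E \<Longrightarrow> \<exists>c. S i v = c *s v" by auto
  have op: "vec_op (S i)" for i
    using normal[of i] by (simp add: normal_vec_op_def)
  define V where "V = {x. \<forall>v\<in>E. cinner_vec x v = 0}"
  have "V \<noteq> {0}"
    unfolding V_def using E Suc.prems by (intro corthonormal_complement_nonzero) auto
  moreover have "vec.subspace V"
    unfolding V_def vec.subspace_def
    by (auto simp: cinner_vec_add_left cinner_vec_scale_left) (simp add: cinner_vec_def)
  moreover have "S i x \<in> V" if "x \<in> V" for i x
    using that E(4) normal_eigenvector_complement[OF normal[of i]] unfolding V_def by blast
  ultimately obtain w where w: "w \<in> V" "w \<noteq> 0" "\<And>i. \<exists>c. S i w = c *s w"
    using exists_common_eigenvector[of S V] op comm by metis
  define r where "r = complex_of_real (inverse (norm w))"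
  define u where "u = r *s w"
  have "cinner_vec u u = of_real ((inverse (norm w))\<^sup>2 * (norm w)\<^sup>2)"
    unfolding u_def r_def cinner_vec_scale_left cinner_vec_scale_right
    unfolding cinner_vec_self by (simp add: power2_eq_square)
  also have "(inverse (norm w))\<^sup>2 * (norm w)\<^sup>2 = 1"
    unfolding power_mult_distrib[symmetric] using w(2) by simp
  finally have uu: "cinner_vec u u = 1" by simp
  have uv: "cinner_vec u v = 0" "cinner_vec v u = 0" if "v \<in> E" for v
  proof -
    show "cinner_vec u v = 0"
      using w(1) that by (simp add: u_def V_def cinner_vec_scale_left)
    then show "cinner_vec v u = 0"
      by (metis cinner_vec_cnj complex_cnj_zero)
  qed
  \<comment> \<open>A member of \<open>E\<close> would be orthogonal to itself, against norm 1; so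
    the cardinality really grows.\<close>
  have "u \<notin> E" using uu uv(1)[of u] by auto
  moreover have "corthonormal (insert u E)"
    using E(3) uu uv \<open>u \<notin> E\<close> by (auto simp: corthonormal_def)
  moreover have "\<exists>c. S i u = c *s u" for i
  proof -
    obtain c where "S i w = c *s w" using w(3) by blast
    then have "S i u = c *s u"
      by (simp add: u_def vec_op_scale[OF op] mult.commute)
    then show ?thesis by blast
  qed
  ultimately show ?case
    using E by (intro exI[of _ "insert u E"]) auto
qed

section \<open>The conjugate transpose and the diagonalizing unitary\<close>

definition cadjoint :: "complex^'n^'n \<Rightarrow> complex^'n^'n" where
  "cadjoint W = (\<chi> i j. cnj (W $ j $ i))"

lemma cadjoint_cadjoint: "cadjoint (cadjoint W) = W"
  by (simp add: cadjoint_def vec_eq_iff)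

lemma cinner_vec_cadjoint: "cinner_vec (W *v x) y = cinner_vec x (cadjoint W *v y)"
proof -
  have "cinner_vec (W *v x) y = (\<Sum>i\<in>UNIV. \<Sum>j\<in>UNIV. W $ i $ j * x $ j * cnj (y $ i))"
    by (simp add: cinner_vec_def matrix_vector_mult_def sum_distrib_right)
  also have "\<dots> = (\<Sum>j\<in>UNIV. \<Sum>i\<in>UNIV. W $ i $ j * x $ j * cnj (y $ i))"
    by (rule sum.swap)
  also have "\<dots> = cinner_vec x (cadjoint W *v y)"
    by (simp add: cinner_vec_def matrix_vector_mult_def cadjoint_def sum_distrib_left
        algebra_simps)
  finally show ?thesis .
qed

lemma simultaneous_unitary_diagonalization:
  fixes S :: "'i \<Rightarrow> complex^'n \<Rightarrow> complex^'n"
  assumes normal: "\<And>i. normal_vec_op (S i)" and comm: "\<And>i j x. S i (S j x) = S j (S i x)"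
  obtains W :: "complex^'n^'n" where "cadjoint W ** W = mat 1" "W ** cadjoint W = mat 1"
    "\<And>i. diagonal_vec_op (\<lambda>x. cadjoint W *v S i (W *v x))"
proof -
  obtain E where E: "finite E" "card E = CARD('n)" "corthonormal E"
    and eig: "\<And>v i. v \<in> E \<Longrightarrow> \<exists>c. S i v = c *s v"
    using exists_orthonormal_common_eigenvectors[OF assms order_refl] by metis
  obtain e :: "'n \<Rightarrow> complex^'n" where e: "bij_betw e UNIV E"
    using finite_same_card_bij[of "UNIV :: 'n set" E] E by auto
  have e_in: "e i \<in> E" for i using e by (auto simp: bij_betw_def)
  have orth: "cinner_vec (e i) (e j) = (if i = j then 1 else 0)" for i j
    using E(3) e_in e by (auto simp: corthonormal_def bij_betw_def inj_eq)
  \<comment> \<open>The columns of \<open>W\<close> are the common eigenvectors, so the entries of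
    \<open>cadjoint W ** W\<close> are their inner products up to conjugation.\<close>
  define W :: "complex^'n^'n" where "W = (\<chi> i j. e j $ i)"
  have WW: "cadjoint W ** W = mat 1"
    using orth
    by (simp add: vec_eq_iff matrix_matrix_mult_def cadjoint_def W_def mat_def cinner_vec_def
        mult.commute)
  moreover from this have "W ** cadjoint W = mat 1"
    by (simp add: matrix_left_right_inverse)
  moreover have "diagonal_vec_op (\<lambda>x. cadjoint W *v S i (W *v x))" for i
  proof -
    have op: "vec_op (S i)"
      using normal[of i] by (simp add: normal_vec_op_def)
    obtain c where c: "\<And>j. S i (e j) = c j *s e j"
      using eig[OF e_in] by metis
    define M :: "complex^'n^'n" where "M = (\<chi> j l. if j = l then c j else 0)"
    have Wx: "W *v x = (\<Sum>j\<in>UNIV. x $ j *s e j)" for x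
      by (simp add: vec_eq_iff matrix_vector_mult_def W_def mult.commute)
    have Mx: "(M *v x) $ j = c j * x $ j" for x j
    proof -
      have "(M *v x) $ j = (\<Sum>l\<in>UNIV. if j = l then c j * x $ j else 0)"
        by (simp only: matrix_vector_mult_def M_def vec_lambda_beta) (intro sum.cong, auto)
      then show ?thesis by simp
    qed
    have "cadjoint W *v S i (W *v x) = M *v x" for x
    proof -
      \<comment> \<open>Both sides are the combination of the \<open>e j\<close> with coefficients
        \<open>c j * x $ j\<close>; multiplying by \<open>cadjoint W\<close> cancels
        \<open>W\<close> on the right-hand side.\<close>
      have "S i (W *v x) = W *v (M *v x)"
        unfolding Wx vec_op_sum[OF op] vec_op_scale[OF op] c Mx
        by (simp add: mult.commute)
      then show ?thesis
        by (simp add: matrix_vector_mul_assoc WW matrix_mul_assoc)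
    qed
    then show ?thesis
      unfolding diagonal_vec_op_def by (intro exI[of _ M]) (auto simp: M_def)
  qed
  ultimately show thesis by (rule that)
qed


section \<open>Coordinatewise unitaries\<close>

lemma norm_isometry_vec:
  assumes "cadjoint W ** W = mat 1"
  shows "norm (W *v x) = norm x"
proof -
  have "complex_of_real ((norm (W *v x))\<^sup>2) = of_real ((norm x)\<^sup>2)"
    unfolding cinner_vec_self[symmetric]
    by (simp add: cinner_vec_cadjoint matrix_vector_mul_assoc assms)
  then show ?thesis by (simp only: of_real_eq_iff) simp
qed

lemma vec_op_matrix: "vec_op ((*v) W)"
  by (simp add: vec_op_def matrix_vector_mul_linear_gen)

text \<open>Norms are preserved in every coordinate, so square-summability and the norm of the
  sequence carry over, with bound 1.\<close>

lemma ell2_op_coordinatewise_isometry: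
  assumes "cadjoint W ** W = mat 1"
  shows "ell2_op (\<lambda>x n. W *v x n)"
  unfolding ell2_op_def
proof (intro conjI ballI allI exI[of _ 1])
  show "ell2_norm (\<lambda>n. W *v x n) \<le> 1 * ell2_norm x" for x
    by (simp add: ell2_norm_def norm_isometry_vec[OF assms])
qed (simp_all add: ell2_def norm_isometry_vec[OF assms] vec_op_add[OF vec_op_matrix]
  vec_op_scale[OF vec_op_matrix])

text \<open>The adjoint, which is also the inverse, applies \<open>cadjoint W\<close> in each
  coordinate; the inner products agree term by term.\<close>

lemma ell2_unitary_coordinatewise:
  assumes "cadjoint W ** W = mat 1" "W ** cadjoint W = mat 1"
  shows "ell2_unitary (\<lambda>x n. W *v x n)"
  unfolding ell2_unitary_def
  by (intro conjI exI[of _ "\<lambda>x n. cadjoint W *v x n"] ell2_op_coordinatewise_isometry)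
    (simp_all add: assms cadjoint_cadjoint ell2_inner_def cinner_vec_cadjoint
      matrix_vector_mul_assoc)

text \<open>Conjugation by a unitary is invertible, so it creates no zero weight, and isometric, so
  the bound on the norms survives.\<close>

lemma shift_weights_conjugate:
  assumes S: "shift_weights S" and W: "cadjoint W ** W = mat 1" "W ** cadjoint W = mat 1"
  shows "shift_weights (\<lambda>n x. cadjoint W *v S n (W *v x))"
  unfolding shift_weights_def
proof (intro conjI allI notI)
  have op: "vec_op (S n)" for n
    using S by (simp add: shift_weights_def)
  show "vec_op (\<lambda>x. cadjoint W *v S n (W *v x))" for n
    unfolding vec_op_def Vector_Spaces.linear_iff
    by (simp add: vec_op_add[OF vec_op_matrix] vec_op_scale[OF vec_op_matrix]
        vec_op_add[OF op] vec_op_scale[OF op] vec.vector_space_axioms)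
  show False if zero: "(\<lambda>x. cadjoint W *v S n (W *v x)) = (\<lambda>x. 0)" for n
  proof -
    \<comment> \<open>Undoing the conjugation recovers \<open>S n\<close>, so a vanishing conjugate
      would give a zero weight of the original shift.\<close>
    have "S n x = W *v (cadjoint W *v S n (W *v (cadjoint W *v x)))" for x
      by (simp add: matrix_vector_mul_assoc W)
    also have "\<dots> x = 0" for x
      using fun_cong[OF zero, of "cadjoint W *v x"] by simp
    finally show False
      using S by (auto simp: shift_weights_def)
  qed
  obtain M where M: "\<And>n. onorm (S n) \<le> M"
    using S by (auto simp: shift_weights_def bdd_above_def)
  have "onorm (\<lambda>x. cadjoint W *v S n (W *v x)) \<le> M" for n
  proof (rule onorm_le)
    fix x
    have "norm (cadjoint W *v S n (W *v x)) = norm (S n (W *v x))"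
      by (simp add: norm_isometry_vec cadjoint_cadjoint W)
    also have "\<dots> \<le> onorm (S n) * norm (W *v x)"
      by (rule onorm[OF vec_op_bounded_linear[OF op]])
    also have "\<dots> \<le> M * norm x"
      unfolding norm_isometry_vec[OF W(1)] by (intro mult_right_mono M) simp
    finally show "norm (cadjoint W *v S n (W *v x)) \<le> M * norm x" .
  qed
  then show "bdd_above (range (\<lambda>n. onorm (\<lambda>x. cadjoint W *v S n (W *v x))))"
    by (auto simp: bdd_above_def)
qed

theorem proposition2p9:
  fixes S :: "int \<Rightarrow> complex^'n \<Rightarrow> complex^'n"
  assumes "CARD('n) \<ge> 2"
    and "shift_weights S"
    and "\<And>n. normal_vec_op (S n)"
    and "\<And>m n. S m \<circ> S n = S n \<circ> S m"
  shows "\<exists>D :: int \<Rightarrow> complex^'n \<Rightarrow> complex^'n.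
           shift_weights D \<and>
           unitarily_equivalent (bilateral_shift S) (bilateral_shift D) \<and>
           (\<forall>n. diagonal_vec_op (D n))"
proof -
  have "S m (S n x) = S n (S m x)" for m n x
    using fun_cong[OF assms(4)[of m n], of x] by simp
  then obtain W :: "complex^'n^'n"
    where W: "cadjoint W ** W = mat 1" "W ** cadjoint W = mat 1"
      and diag: "\<And>n. diagonal_vec_op (\<lambda>x. cadjoint W *v S n (W *v x))"
    using simultaneous_unitary_diagonalization[of S] assms(3) by blast
  define D where "D n x = cadjoint W *v S n (W *v x)" for n x
  have D: "shift_weights D"
    unfolding D_def by (rule shift_weights_conjugate[OF assms(2) W])
  have "ell2_unitary (\<lambda>x n. cadjoint W *v x n)"
    by (rule ell2_unitary_coordinatewise) (simp_all add: cadjoint_cadjoint W)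
  \<comment> \<open>The same matrix acts at positions n and n - 1, so the index shift is harmless
    and the inner \<open>W ** cadjoint W\<close> cancels.\<close>
  moreover have "(\<lambda>n. cadjoint W *v bilateral_shift S x n)
      = bilateral_shift D (\<lambda>n. cadjoint W *v x n)" for x
    by (simp add: bilateral_shift_def D_def matrix_vector_mul_assoc W)
  ultimately have "unitarily_equivalent (bilateral_shift S) (bilateral_shift D)"
    unfolding unitarily_equivalent_def
    using bilateral_shift_ell2_op[OF assms(2)] bilateral_shift_ell2_op[OF D] by blast
  moreover have "diagonal_vec_op (D n)" for n
    using diag[of n] by (simp add: D_def[abs_def])
  ultimately show ?thesis
    using D by blast
qed

end
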